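(* For every $s$ with $\mathrm{Re}(s)\ge0$ such that $\det D(s+l\mu c)\ne0$ for all $l=0,1,2,\ldots$, $$\tilde Z(s)=\sum_{k=0}^\infty\prod_{l=0}^{k-1}M(s+l\mu c)\,A(s+k\mu c)\,\tilde v ,$$ where $D(s)=sI-\Lambda(I-P^T)$, $A(s)=sD^{-1}(s)$ and $M(s)=\frac1{\mu+s}A(s)\Lambda P^T$.
   Context: Let $E=\{1,\ldots,N\}$, $c>0$, $\mu>0$. $(Y_n)_{n\ge0}$ is an irreducible discrete-time Markov chain on $E$ with transition matrix $P=(p_{i,j})$ and stationary distribution $\tilde\pi=(\pi_1,\ldots,\pi_N)^T$. The waiting time process $W_n\ge0$ satisfies $W_{n+1}=[W_n+[S_n-cW_n]^+-A_{n+1}]^+$, $[x]^+=\max(0,x)$ (if the waiting time of the $n$th customer is $W_n$, the service time is $[S_n-cW_n]^+$). Given $Y_n$, the triple $(A_{n+1},S_n,Y_{n+1})$ is independent of the past (in particular of $W_n$), and for $x,y\ge0$ $$P(A_{n+1}\le x,S_n\le y,Y_{n+1}=j\mid Y_n=i)=p_{i,j}(1-e^{-\mu y})(1-e^{-\lambda_jx}),\qquad\lambda_j>0.$$ Notation: $\Lambda=\mathrm{diag}(\lambda_1,\ldots,\lambda_N)$. For $\mathrm{Re}(s)\ge0$, $Z_i(s)=\lim_{n\to\infty}E(e^{-sW_n}1_{\{Y_n=i\}})$; it is assumed that these limits exist and are the transforms $E(e^{-sW}1_{\{Y=i\}})$ of a steady-state pair $(W,Y)$ with $W$ finite and $P(Y=i)=\pi_i$.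 $\tilde Z(s)=(Z_1(s),\ldots,Z_N(s))^T$, and $\tilde v=(v_1,\ldots,v_N)^T$ with $v_j=\sum_{i=1}^Np_{i,j}\big[Z_i(\lambda_j)-\frac{\lambda_j}{\mu+\lambda_j}Z_i(\lambda_j+\mu c)\big]$. Matrix products are ordered with increasing index from left to right; empty products are the identity. *)

theory Defs
  imports "HOL-Probability.Probability"
begin

definition stochastic_matrix :: "real ^ 'n ^ 'n \<Rightarrow> bool" where
  "stochastic_matrix P \<longleftrightarrow> (\<forall>i j. 0 \<le> P $ i $ j) \<and> (\<forall>i. (\<Sum>j\<in>UNIV. P $ i $ j) = 1)"

text \<open>\<open>((**) P ^^ k) (mat 1)\<close> is the \<open>k\<close>-th power of \<open>P\<close>, i.e. the \<open>k\<close>-step transition matrix.\<close>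

definition irreducible_matrix :: "real ^ 'n ^ 'n \<Rightarrow> bool" where
  "irreducible_matrix P \<longleftrightarrow> (\<forall>i j. \<exists>k. 0 < ((**) P ^^ k) (mat 1) $ i $ j)"

definition stationary_distribution :: "real ^ 'n \<Rightarrow> real ^ 'n ^ 'n \<Rightarrow> bool" where
  "stationary_distribution q P \<longleftrightarrow>
     (\<forall>i. 0 \<le> q $ i) \<and> (\<Sum>i\<in>UNIV. q $ i) = 1 \<and> q v* P = q"

definition markov_chain :: "'a measure \<Rightarrow> (nat \<Rightarrow> 'a \<Rightarrow> 'n) \<Rightarrow> real ^ 'n ^ 'n \<Rightarrow> bool" where
  "markov_chain M Y P \<longleftrightarrow>
     (\<forall>n. Y n \<in> measurable M (count_space UNIV)) \<and>
     (\<forall>n y j. \<P>(\<omega> in M. \<forall>k\<le>n. Y k \<omega> = y k) > 0 \<longrightarrow>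
        \<P>(\<omega> in M. Y (Suc n) \<omega> = j \<bar> \<forall>k\<le>n. Y k \<omega> = y k) = P $ (y n) $ j)"

text \<open>The \<open>\<sigma>\<close>-algebra generated by \<open>W\<^sub>0, \<dots>, W\<^sub>n\<close>, \<open>Y\<^sub>0, \<dots>, Y\<^sub>n\<close>, \<open>A\<^sub>1, \<dots>, A\<^sub>n\<close> and
  \<open>S\<^sub>0, \<dots>, S\<^sub>n\<^sub>-\<^sub>1\<close>. The sequence \<open>A\<close> starts at index 1; its value at 0 is never used.\<close>

definition past_events ::
  "'a measure \<Rightarrow> (nat \<Rightarrow> 'a \<Rightarrow> real) \<Rightarrow> (nat \<Rightarrow> 'a \<Rightarrow> real) \<Rightarrow> (nat \<Rightarrow> 'a \<Rightarrow> real) \<Rightarrow>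
    (nat \<Rightarrow> 'a \<Rightarrow> 'n) \<Rightarrow> nat \<Rightarrow> 'a set set" where
  "past_events M W A S Y n = sigma_sets (space M)
     ({W k -` B \<inter> space M | k B. k \<le> n \<and> B \<in> sets borel} \<union>
      {Y k -` B \<inter> space M | k B. k \<le> n} \<union>
      {A k -` B \<inter> space M | k B. 1 \<le> k \<and> k \<le> n \<and> B \<in> sets borel} \<union>
      {S k -` B \<inter> space M | k B. k < n \<and> B \<in> sets borel})"

definition step_events ::
  "'a measure \<Rightarrow> (nat \<Rightarrow> 'a \<Rightarrow> real) \<Rightarrow> (nat \<Rightarrow> 'a \<Rightarrow> real) \<Rightarrow> (nat \<Rightarrow> 'a \<Rightarrow> 'n) \<Rightarrow>
    nat \<Rightarrow> 'a set set" where
  "step_events M A S Y n =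
     {(\<lambda>\<omega>. (A (Suc n) \<omega>, S n \<omega>, Y (Suc n) \<omega>)) -` B \<inter> space M | B.
        B \<in> sets (borel \<Otimes>\<^sub>M borel \<Otimes>\<^sub>M count_space UNIV)}"

text \<open>\<open>uniform_measure M E\<close> is the conditional probability measure given the event \<open>E\<close>.\<close>

definition step_indep_of_past ::
  "'a measure \<Rightarrow> (nat \<Rightarrow> 'a \<Rightarrow> real) \<Rightarrow> (nat \<Rightarrow> 'a \<Rightarrow> real) \<Rightarrow> (nat \<Rightarrow> 'a \<Rightarrow> real) \<Rightarrow>
    (nat \<Rightarrow> 'a \<Rightarrow> 'n) \<Rightarrow> bool" where
  "step_indep_of_past M W A S Y \<longleftrightarrow>
     (\<forall>n i. \<P>(\<omega> in M. Y n \<omega> = i) > 0 \<longrightarrow>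
        prob_space.indep_set (uniform_measure M {\<omega> \<in> space M. Y n \<omega> = i})
          (past_events M W A S Y n) (step_events M A S Y n))"

definition joint_transform ::
  "'a measure \<Rightarrow> ('a \<Rightarrow> real) \<Rightarrow> ('a \<Rightarrow> 'n) \<Rightarrow> 'n \<Rightarrow> complex \<Rightarrow> complex" where
  "joint_transform M X U i s =
     (LINT \<omega>|M. exp (- s * complex_of_real (X \<omega>)) * of_bool (U \<omega> = i))"

definition Z_vec ::
  "'a measure \<Rightarrow> (nat \<Rightarrow> 'a \<Rightarrow> real) \<Rightarrow> (nat \<Rightarrow> 'a \<Rightarrow> 'n) \<Rightarrow> complex \<Rightarrow> complex ^ 'n" where
  "Z_vec M W Y s = (\<chi> i. lim (\<lambda>n. joint_transform M (W n) (Y n) i s))"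

definition v_vec ::
  "(complex \<Rightarrow> complex ^ 'n) \<Rightarrow> real ^ 'n ^ 'n \<Rightarrow> real ^ 'n \<Rightarrow> real \<Rightarrow> real \<Rightarrow> complex ^ 'n" where
  "v_vec Z P lam mu c = (\<chi> j. \<Sum>i\<in>UNIV. of_real (P $ i $ j) *
     (Z (of_real (lam $ j)) $ i
       - of_real (lam $ j / (mu + lam $ j)) * Z (of_real (lam $ j + mu * c)) $ i))"

definition cmatrix :: "real ^ 'n ^ 'm \<Rightarrow> complex ^ 'n ^ 'm" where
  "cmatrix B = (\<chi> i j. complex_of_real (B $ i $ j))"

definition scale_mat :: "complex \<Rightarrow> complex ^ 'n ^ 'm \<Rightarrow> complex ^ 'n ^ 'm" where
  "scale_mat a B = (\<chi> i j. a * B $ i $ j)"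

definition Lambda_mat :: "real ^ 'n \<Rightarrow> complex ^ 'n ^ 'n" where
  "Lambda_mat lam = (\<chi> i j. if i = j then complex_of_real (lam $ i) else 0)"

definition D_mat :: "real ^ 'n ^ 'n \<Rightarrow> real ^ 'n \<Rightarrow> complex \<Rightarrow> complex ^ 'n ^ 'n" where
  "D_mat P lam s =
     scale_mat s (mat 1) - Lambda_mat lam ** (mat 1 - transpose (cmatrix P))"

definition A_mat :: "real ^ 'n ^ 'n \<Rightarrow> real ^ 'n \<Rightarrow> complex \<Rightarrow> complex ^ 'n ^ 'n" where
  "A_mat P lam s = scale_mat s (matrix_inv (D_mat P lam s))"

definition M_mat :: "real ^ 'n ^ 'n \<Rightarrow> real ^ 'n \<Rightarrow> real \<Rightarrow> complex \<Rightarrow> complex ^ 'n ^ 'n" where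
  "M_mat P lam mu s = scale_mat (1 / (of_real mu + s))
     (A_mat P lam s ** Lambda_mat lam ** transpose (cmatrix P))"

text \<open>\<open>ordered_prod F k = F 0 ** F 1 ** \<dots> ** F (k - 1)\<close>\<close>

primrec ordered_prod :: "(nat \<Rightarrow> complex ^ 'n ^ 'n) \<Rightarrow> nat \<Rightarrow> complex ^ 'n ^ 'n" where
  "ordered_prod F 0 = mat 1"
| "ordered_prod F (Suc k) = ordered_prod F k ** F k"

end

theory Submission
  imports Defs "HOL-Real_Asymp.Real_Asymp"
begin

text \<open>Conditionally on \<open>Y\<^sub>n = i\<close> and \<open>Y\<^sub>n\<^sub>+\<^sub>1 = j\<close> the quantities \<open>W\<^sub>n\<close>, \<open>S\<^sub>n\<close>, \<open>A\<^sub>n\<^sub>+\<^sub>1\<close> are independent, the last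
  two being exponential with rates \<open>\<mu>\<close> and \<open>\<lambda>\<^sub>j\<close>. Write \<open>V = W + max 0 (S - c W)\<close> for the sojourn time. Two
  elementary integrals then drive everything. Averaging over the interarrival time turns
  \<open>(s - \<lambda>) E exp (-s max 0 (V - A))\<close> into \<open>s E exp (-\<lambda> V) - \<lambda> E exp (-s V)\<close>, and averaging over the service
  time turns \<open>E exp (-s V)\<close> into \<open>E exp (-s W) - s / (\<mu> + s) E exp (-(s + \<mu> c) W)\<close>. Because the service
  time is reduced by an amount linear in \<open>W\<close>, the second integral shifts the argument of the
  transform by \<open>\<mu> c\<close>.

  Summing over the predecessor state \<open>i\<close> (\<open>joint_transform_step\<close>) and letting \<open>n\<close> tend to infinity gives
  \<open>D(s) Z(s) = s v + s / (\<mu> + s) \<Lambda> P\<^sup>T Z(s + \<mu> c)\<close>; the values of the transform at \<open>\<lambda>\<^sub>j\<close> and \<open>\<lambda>\<^sub>j + \<mu> c\<close> are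
  collected in \<open>v\<close>. Where \<open>D(s)\<close> is invertible this reads \<open>Z(s) = A(s) v + M(s) Z(s + \<mu> c)\<close>.

  Iterating the recursion \<open>k\<close> times leaves the partial sum of the series and the remainder
  \<open>M(s) M(s + \<mu> c) \<dots> M(s + (k - 1) \<mu> c) Z(s + k \<mu> c)\<close> (\<open>sums_ordered_prod_if_recursion\<close>). The vector \<open>Z\<close> is
  bounded on the right half plane, \<open>A(s)\<close> stays bounded as \<open>s\<close> tends to infinity (it tends to the
  identity), and the factor \<open>1 / (\<mu> + s)\<close> makes \<open>M(s)\<close> tend to zero. So all but finitely many factors
  halve the norm, and the remainder vanishes (\<open>eventually_norm_M_mat_le\<close>,
  \<open>ordered_prod_mult_tendsto_zero\<close>).\<close>

section \<open>Exponential integrals\<close>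

abbreviation exp_law :: "real \<Rightarrow> real measure" where
  "exp_law l \<equiv> density lborel (\<lambda>x. ennreal (exponential_density l x))"

lemma has_vector_derivative_exp_linear:
  fixes z :: complex
  assumes "z \<noteq> 0"
  shows "((\<lambda>x::real. - exp (- z * of_real x) / z) has_vector_derivative exp (- z * of_real x)) (at x within T)"
  using assms
  by (intro has_vector_derivative_real_field[where f="\<lambda>u. - exp (- z * u) / z"])
     (auto intro!: derivative_eq_intros)

lemma integrable_exponential_density:
  assumes "l > 0"
  shows "integrable lborel (exponential_density l)"
proof (rule integrableI_nonneg)
  show "(\<integral>\<^sup>+x. ennreal (exponential_density l x) \<partial>lborel) < \<infinity>"
    using nn_integral_erlang_ith_moment[OF assms, of 0 0] by simp
qed (use assms in auto)

text \<open>The integrals over the segments from \<open>a\<close> to \<open>a + n\<close> come from the fundamental theorem of calculus; the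
  exponential density with rate \<open>Re z\<close>, rescaled, dominates them.\<close>

lemma has_bochner_integral_exp_tail:
  fixes z :: complex and a :: real
  assumes z: "Re z > 0" and a: "a \<ge> 0"
  shows "has_bochner_integral lborel (\<lambda>x. indicator {a..} x *\<^sub>R exp (- z * of_real x)) (exp (- z * of_real a) / z)"
proof -
  let ?f = "\<lambda>x. indicator {a..} x *\<^sub>R exp (- z * of_real x)"
  let ?u = "\<lambda>(n::nat) x. indicator {a..a + real n} x *\<^sub>R exp (- z * of_real x)"
  let ?w = "\<lambda>x. exponential_density (Re z) x / Re z"
  have z0: "z \<noteq> 0" using z by auto
  have w: "integrable lborel ?w"
    using integrable_exponential_density[OF z] by simp
  have conv: "(\<lambda>n. ?u n x) \<longlonglongrightarrow> ?f x" for x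
  proof (rule tendsto_eventually)
    obtain N :: nat where N: "x - a \<le> real N" using real_arch_simple by blast
    show "\<forall>\<^sub>F n in sequentially. ?u n x = ?f x"
      using eventually_ge_at_top[of N] by eventually_elim (use N in \<open>auto simp: indicator_def\<close>)
  qed
  have bound: "norm (?u n x) \<le> ?w x" for n x
    using z a by (auto simp: indicator_def exponential_density_def norm_mult mult.commute)
  have "integrable lborel ?f"
    by (rule integrable_dominated_convergence[where s = ?u and w = ?w])
       (use w conv bound in auto)
  moreover have "(\<lambda>n. integral\<^sup>L lborel (?u n)) \<longlonglongrightarrow> integral\<^sup>L lborel ?f"
    by (rule integral_dominated_convergence[where w = ?w]) (use w conv bound in auto)
  moreover have "integral\<^sup>L lborel (?u n) = (exp (- z * of_real a) - exp (- z * of_real (a + real n))) / z" for n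
  proof -
    have "integral\<^sup>L lborel (?u n)
        = - exp (- z * of_real (a + real n)) / z - (- exp (- z * of_real a) / z)"
      by (intro integral_FTC_Icc has_vector_derivative_exp_linear z0 continuous_intros) simp
    thus ?thesis by (simp add: diff_divide_distrib)
  qed
  moreover have "(\<lambda>n. (exp (- z * of_real a) - exp (- z * of_real (a + real n))) / z)
      \<longlonglongrightarrow> (exp (- z * of_real a) - 0) / z"
  proof -
    have "(\<lambda>n. exp (- Re z * (a + real n))) \<longlonglongrightarrow> 0"
      using z by real_asymp
    hence "(\<lambda>n. exp (- z * of_real (a + real n))) \<longlonglongrightarrow> 0"
      by (subst tendsto_norm_zero_iff[symmetric]) (simp add: norm_exp_eq_Re)
    thus ?thesis by (intro tendsto_intros z0)
  qed
  ultimately show ?thesis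
    by (auto simp: has_bochner_integral_iff intro: LIMSEQ_unique)
qed

lemma integral_exp_law:
  fixes f :: "real \<Rightarrow> complex"
  assumes "l > 0" and [measurable]: "f \<in> borel_measurable borel"
  shows "integral\<^sup>L (exp_law l) f = (\<integral>x. exponential_density l x *\<^sub>R f x \<partial>lborel)"
  using assms by (intro integral_density) auto

text \<open>The transform of the positive part of \<open>y - b\<close> for an exponential \<open>y\<close>. The integrand is rewritten as a
  combination of exponential tails starting at \<open>0\<close> and at \<open>b\<close>; the two tails that start at \<open>b\<close> cancel
  there, so the identity is exact at the kink too.\<close>

lemma service_transform:
  fixes z :: complex and m b :: real
  assumes m: "m > 0" and z: "Re z \<ge> 0" and b: "b \<ge> 0"
  shows "(\<integral>y. exp (- z * of_real (max 0 (y - b))) \<partial>exp_law m)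
           = 1 - z / (of_real m + z) * exp (- of_real (m * b))"
proof -
  let ?t = "\<lambda>u a x. indicator {a..} x *\<^sub>R exp (- u * complex_of_real x)"
  have mz: "Re (of_real m + z) > 0" "of_real m + z \<noteq> 0" using m z by (auto simp: complex_eq_iff)
  have "(\<integral>y. exp (- z * of_real (max 0 (y - b))) \<partial>exp_law m)
      = (\<integral>y. exponential_density m y *\<^sub>R exp (- z * of_real (max 0 (y - b))) \<partial>lborel)"
    by (intro integral_exp_law m) measurable
  also have "\<dots> = (\<integral>y. of_real m * ?t (of_real m) 0 y - of_real m * ?t (of_real m) b y
      + of_real m * exp (z * of_real b) * ?t (of_real m + z) b y \<partial>lborel)"
    by (intro Bochner_Integration.integral_cong refl)
       (use b in \<open>auto simp: indicator_def exponential_density_def max_def scaleR_conv_of_real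
          exp_of_real[symmetric] algebra_simps simp flip: exp_add\<close>)
  also have "\<dots> = of_real m * (exp (- of_real m * of_real 0) / of_real m)
       - of_real m * (exp (- of_real m * of_real b) / of_real m)
      + of_real m * exp (z * of_real b) * (exp (- (of_real m + z) * of_real b) / (of_real m + z))"
    by (intro has_bochner_integral_integral_eq has_bochner_integral_add has_bochner_integral_diff
        has_bochner_integral_mult_right has_bochner_integral_exp_tail) (use m b mz in auto)
  also have "\<dots> = 1 - exp (- of_real (m * b))
      + of_real m * exp (- of_real (m * b)) / (of_real m + z)"
    using m by (simp add: field_simps flip: exp_add)
  also have "\<dots> = 1 - z / (of_real m + z) * exp (- of_real (m * b))"
    using mz by (simp add: field_simps)
  finally show ?thesis .
qed

text \<open>On the segment from \<open>0\<close> to \<open>v\<close> the integrand is \<open>\<lambda> exp (-z v) exp (-(\<lambda> - z) x)\<close>, whose rate may have negative real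
  part; the integral over this bounded segment exists all the same. Multiplying by \<open>z - \<lambda>\<close> removes the pole at
  \<open>z = \<lambda>\<close>, where both sides vanish. Stated without the division, the identity can thus be used for
  every \<open>z\<close>, also when \<open>z\<close> is one of the arrival rates.\<close>

lemma interarrival_transform:
  fixes z :: complex and l v :: real
  assumes l: "l > 0" and v: "v \<ge> 0"
  shows "(z - of_real l) * (\<integral>x. exp (- z * of_real (max 0 (v - x))) \<partial>exp_law l)
           = z * exp (- of_real (l * v)) - of_real l * exp (- z * of_real v)"
proof (cases "z = of_real l")
  case False
  let ?t = "\<lambda>x. indicator {0..} x *\<^sub>R exp (- of_real l * complex_of_real x)"
  let ?k = "\<lambda>u x. indicator {0..v} x *\<^sub>R exp (- u * complex_of_real x)"
  have k: "has_bochner_integral lborel (?k u) ((1 - exp (- u * of_real v)) / u)" if "u \<noteq> 0" for u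
  proof -
    have "has_bochner_integral lborel (?k u)
       ((- exp (- u * of_real v) / u) - (- exp (- u * of_real 0) / u))"
      by (intro has_bochner_integral_FTC_Icc has_vector_derivative_exp_linear that v continuous_intros)
    thus ?thesis by (simp add: diff_divide_distrib)
  qed
  have lz: "of_real l - z \<noteq> 0" using False by auto
  have "(\<integral>x. exp (- z * of_real (max 0 (v - x))) \<partial>exp_law l)
      = (\<integral>x. exponential_density l x *\<^sub>R exp (- z * of_real (max 0 (v - x))) \<partial>lborel)"
    by (intro integral_exp_law l) measurable
  also have "\<dots> = (\<integral>x. of_real l * exp (- z * of_real v) * ?k (of_real l - z) x
      - of_real l * ?k (of_real l) x + of_real l * ?t x \<partial>lborel)"
    by (intro Bochner_Integration.integral_cong refl)
       (use v in \<open>auto simp: indicator_def exponential_density_def max_def scaleR_conv_of_real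
          exp_of_real[symmetric] algebra_simps simp flip: exp_add\<close>)
  also have "\<dots> = of_real l * exp (- z * of_real v) * ((1 - exp (- (of_real l - z) * of_real v)) / (of_real l - z))
      - of_real l * ((1 - exp (- of_real l * of_real v)) / of_real l)
      + of_real l * (exp (- of_real l * of_real 0) / of_real l)"
    by (intro has_bochner_integral_integral_eq has_bochner_integral_add has_bochner_integral_diff
        has_bochner_integral_mult_right has_bochner_integral_exp_tail k) (use l lz in auto)
  also have "\<dots> = of_real l * (exp (- z * of_real v) - exp (- of_real (l * v))) / (of_real l - z)
      + exp (- of_real (l * v))"
    using l by (simp add: field_simps flip: exp_add)
  finally show ?thesis
    using lz by (simp add: field_simps)
qed simp

section \<open>The joint law of waiting, service and interarrival time on a transition\<close>

text \<open>Uniqueness of finite Borel measures with given multivariate distribution function: the lower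
  orthants form a generator that is closed under intersection. For triples of reals the product
  order makes the lower orthants products of half lines.\<close>

lemma measure_eqI_atMost:
  fixes M N :: "'a::ordered_euclidean_space measure"
  assumes sets: "sets M = sets borel" "sets N = sets borel" and "finite_measure M"
    and eq: "\<And>a. emeasure M {..a} = emeasure N {..a}"
  shows "M = N"
proof (rule measure_eqI_generator_eq)
  interpret finite_measure M by fact
  show "Int_stable (range (\<lambda>a::'a. {..a}))"
  proof (safe intro!: Int_stableI)
    fix a b :: 'a
    have "{..a} \<inter> {..b} = {..inf a b}" by auto
    thus "{..a} \<inter> {..b} \<in> range (\<lambda>a. {..a})" by blast
  qed
  show "sets M = sigma_sets UNIV (range (\<lambda>a::'a. {..a}))"
       "sets N = sigma_sets UNIV (range (\<lambda>a::'a. {..a}))"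
    unfolding sets borel_eq_atMost by (simp_all add: sets_measure_of)
  show "(\<Union>n::nat. {..real n *\<^sub>R (One::'a)}) = UNIV"
  proof safe
    fix x :: 'a
    obtain n :: nat where n: "norm x \<le> real n" using real_arch_simple by blast
    have "x \<bullet> i \<le> real n" if "i \<in> Basis" for i
      using Basis_le_norm[OF that, of x] n by linarith
    hence "x \<le> real n *\<^sub>R (One::'a)"
      by (auto simp: eucl_le[where 'a='a])
    thus "x \<in> (\<Union>n::nat. {..real n *\<^sub>R (One::'a)})" by auto
  qed auto
  show "emeasure M {..real n *\<^sub>R (One::'a)} \<noteq> \<infinity>" for n :: nat
    by simp
qed (use eq in auto)

lemma sets_pair_borel:
  fixes M :: "'a::second_countable_topology measure" and N :: "'b::second_countable_topology measure"
  assumes "sets M = sets borel" "sets N = sets borel"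
  shows "sets (M \<Otimes>\<^sub>M N) = sets borel"
  using sets_pair_measure_cong[OF assms] by (simp only: borel_prod)

lemma finite_measure_distr_restricted:
  assumes "finite_measure M" "E \<in> sets M" "f \<in> measurable M N"
  shows "finite_measure (distr (density M (\<lambda>\<omega>. ennreal (indicator E \<omega>))) N f)"
proof -
  have "finite_measure (density M (indicator E))"
    using assms by (intro finite_measure.finite_measure_restricted) auto
  hence "finite_measure (density M (\<lambda>\<omega>. ennreal (indicator E \<omega>)))"
    by (simp add: ennreal_indicator)
  thus ?thesis
    using assms by (intro finite_measure.finite_measure_distr) auto
qed

lemma emeasure_distr_restricted:
  assumes "E \<in> sets M" "f \<in> measurable M N" "B \<in> sets N"
  shows "emeasure (distr (density M (\<lambda>\<omega>. ennreal (indicator E \<omega>))) N f) B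
    = emeasure M (E \<inter> (f -` B \<inter> space M))"
  using assms by (simp add: ennreal_indicator emeasure_distr emeasure_restricted measurable_sets)

lemma emeasure_exp_law_atMost:
  assumes "l > 0"
  shows "emeasure (exp_law l) {..x} = ennreal (1 - exp (- l * max 0 x))"
  using assms by (simp add: emeasure_erlang_density erlang_CDF_0 max_def)

text \<open>The measures are restricted to the events \<open>E\<close> and \<open>E \<inter> F\<close> rather than conditioned on them. The
  transition probability \<open>p\<close> then appears as a constant density, and the identity stays meaningful
  when \<open>E\<close> or \<open>E \<inter> F\<close> is null.\<close>

lemma joint_law_on_transition:
  fixes M :: "'a measure" and W S A :: "'a \<Rightarrow> real"
  assumes "prob_space M"
    and [measurable]: "W \<in> borel_measurable M" "S \<in> borel_measurable M" "A \<in> borel_measurable M"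
      "E \<in> sets M" "F \<in> sets M"
    and p: "p \<ge> 0" and m: "m > 0" and l: "l > 0"
    and law: "\<And>w y x. y \<ge> 0 \<Longrightarrow> x \<ge> 0 \<Longrightarrow>
        measure M {\<omega> \<in> space M. \<omega> \<in> E \<and> \<omega> \<in> F \<and> W \<omega> \<le> w \<and> S \<omega> \<le> y \<and> A \<omega> \<le> x}
          = measure M {\<omega> \<in> space M. \<omega> \<in> E \<and> W \<omega> \<le> w} * (p * (1 - exp (- m * y)) * (1 - exp (- l * x)))"
  shows "distr (density M (\<lambda>\<omega>. ennreal (indicator (E \<inter> F) \<omega>))) borel (\<lambda>\<omega>. (W \<omega>, S \<omega>, A \<omega>))
    = density (distr (density M (\<lambda>\<omega>. ennreal (indicator E \<omega>))) borel W \<Otimes>\<^sub>M (exp_law m \<Otimes>\<^sub>M exp_law l))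
        (\<lambda>_. ennreal p)" (is "?L = density (?W \<Otimes>\<^sub>M ?X) _")
proof (rule measure_eqI_atMost)
  interpret prob_space M by fact
  interpret Pm: prob_space "exp_law m" using m by (rule prob_space_exponential_density)
  interpret Pl: prob_space "exp_law l" using l by (rule prob_space_exponential_density)
  interpret X: pair_prob_space "exp_law m" "exp_law l" ..
  show "sets ?L = sets borel" by simp
  have sets: "sets (?W \<Otimes>\<^sub>M ?X) = sets borel"
    by (intro sets_pair_borel) simp_all
  thus "sets (density (?W \<Otimes>\<^sub>M ?X) (\<lambda>_. ennreal p)) = sets borel" by (simp only: sets_density)
  show "finite_measure ?L"
    by (intro finite_measure_distr_restricted) (simp_all add: finite_measure_axioms)
  fix a :: "real \<times> real \<times> real"
  obtain w y x where a: "a = (w, y, x)" by (cases a)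
  let ?T = "\<lambda>y x. {\<omega> \<in> space M. \<omega> \<in> E \<and> \<omega> \<in> F \<and> W \<omega> \<le> w \<and> S \<omega> \<le> y \<and> A \<omega> \<le> x}"
  have L: "emeasure ?L {..a} = ennreal (measure M (?T y x))"
  proof -
    have "emeasure ?L {..a} = emeasure M (E \<inter> F \<inter> ((\<lambda>\<omega>. (W \<omega>, S \<omega>, A \<omega>)) -` {..a} \<inter> space M))"
      by (intro emeasure_distr_restricted) auto
    also have "E \<inter> F \<inter> ((\<lambda>\<omega>. (W \<omega>, S \<omega>, A \<omega>)) -` {..a} \<inter> space M) = ?T y x"
      by (auto simp: a)
    finally show ?thesis by (simp add: emeasure_eq_measure)
  qed
  have W: "emeasure ?W {..w} = ennreal (measure M {\<omega> \<in> space M. \<omega> \<in> E \<and> W \<omega> \<le> w})"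
  proof -
    have "emeasure ?W {..w} = emeasure M (E \<inter> (W -` {..w} \<inter> space M))"
      by (intro emeasure_distr_restricted) auto
    also have "E \<inter> (W -` {..w} \<inter> space M) = {\<omega> \<in> space M. \<omega> \<in> E \<and> W \<omega> \<le> w}"
      by auto
    finally show ?thesis by (simp add: emeasure_eq_measure)
  qed
  have R: "emeasure (density (?W \<Otimes>\<^sub>M ?X) (\<lambda>_. ennreal p)) {..a}
      = ennreal p * (emeasure ?W {..w} * (emeasure (exp_law m) {..y} * emeasure (exp_law l) {..x}))"
  proof -
    have "{..a} = {..w} \<times> ({..y} \<times> {..x})" by (auto simp: a)
    moreover have "{..w} \<times> ({..y} \<times> {..x}) \<in> sets (?W \<Otimes>\<^sub>M ?X)" by (intro pair_measureI) auto
    moreover have "emeasure (?W \<Otimes>\<^sub>M ?X) ({..w} \<times> ({..y} \<times> {..x})) = emeasure ?W {..w} * emeasure ?X ({..y} \<times> {..x})"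
      by (intro X.P.emeasure_pair_measure_Times pair_measureI) auto
    moreover have "emeasure ?X ({..y} \<times> {..x}) = emeasure (exp_law m) {..y} * emeasure (exp_law l) {..x}"
      by (intro Pl.emeasure_pair_measure_Times) auto
    ultimately show ?thesis by (simp only: emeasure_density_const)
  qed
  (* The hypothesis covers nonnegative bounds only. If y or x is negative, the event is contained in
     the one with that bound raised to 0, which is null as the factor 1 - exp 0 occurs. *)
  have T: "measure M (?T y x) = measure M {\<omega> \<in> space M. \<omega> \<in> E \<and> W \<omega> \<le> w}
      * (p * (1 - exp (- m * max 0 y)) * (1 - exp (- l * max 0 x)))"
  proof (cases "y \<ge> 0 \<and> x \<ge> 0")
    case True
    thus ?thesis using law[of y x w] by simp
  next
    case False
    have "measure M (?T y x) \<le> measure M (?T (max 0 y) (max 0 x))"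
      by (rule finite_measure_mono) auto
    also have "\<dots> = 0"
      using False law[of "max 0 y" "max 0 x" w] by (auto simp: max_def)
    finally show ?thesis using False
      by (auto simp: max_def measure_le_0_iff)
  qed
  show "emeasure ?L {..a} = emeasure (density (?W \<Otimes>\<^sub>M ?X) (\<lambda>_. ennreal p)) {..a}"
  proof -
    have eq: "ennreal (u * (p * v * v')) = ennreal p * (ennreal u * (ennreal v * ennreal v'))"
      if "u \<ge> 0" "v \<ge> 0" "v' \<ge> 0" for u v v'
      using that p by (simp add: mult_ac flip: ennreal_mult)
    show ?thesis
      unfolding L R T W emeasure_exp_law_atMost[OF m] emeasure_exp_law_atMost[OF l]
      by (rule eq) (use m l in auto)
  qed
qed

lemma integral_on_transition:
  fixes M :: "'a measure" and W S A :: "'a \<Rightarrow> real" and h :: "real \<times> real \<times> real \<Rightarrow> complex"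
  assumes "prob_space M"
    and [measurable]: "W \<in> borel_measurable M" "S \<in> borel_measurable M" "A \<in> borel_measurable M"
      "E \<in> sets M" "F \<in> sets M"
    and p: "p \<ge> 0" and m: "m > 0" and l: "l > 0"
    and law: "\<And>w y x. y \<ge> 0 \<Longrightarrow> x \<ge> 0 \<Longrightarrow>
        measure M {\<omega> \<in> space M. \<omega> \<in> E \<and> \<omega> \<in> F \<and> W \<omega> \<le> w \<and> S \<omega> \<le> y \<and> A \<omega> \<le> x}
          = measure M {\<omega> \<in> space M. \<omega> \<in> E \<and> W \<omega> \<le> w} * (p * (1 - exp (- m * y)) * (1 - exp (- l * x)))"
    and h[measurable]: "h \<in> borel_measurable borel" and bound: "\<And>u. norm (h u) \<le> B"
  shows "(\<integral>\<omega>. indicator (E \<inter> F) \<omega> *\<^sub>R h (W \<omega>, S \<omega>, A \<omega>) \<partial>M)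
    = p *\<^sub>R (\<integral>\<omega>. indicator E \<omega> *\<^sub>R (\<integral>y. \<integral>x. h (W \<omega>, y, x) \<partial>exp_law l \<partial>exp_law m) \<partial>M)"
proof -
  interpret prob_space M by fact
  interpret Pm: prob_space "exp_law m" using m by (rule prob_space_exponential_density)
  interpret Pl: prob_space "exp_law l" using l by (rule prob_space_exponential_density)
  interpret X: pair_prob_space "exp_law m" "exp_law l" ..
  let ?X = "exp_law m \<Otimes>\<^sub>M exp_law l"
  let ?W = "distr (density M (\<lambda>\<omega>. ennreal (indicator E \<omega>))) borel W"
  interpret W: finite_measure ?W
    by (intro finite_measure_distr_restricted) (simp_all add: finite_measure_axioms)
  interpret WX: pair_sigma_finite ?W ?X ..
  interpret WX: finite_measure "?W \<Otimes>\<^sub>M ?X"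
    by (rule finite_measure_pair_measure) unfold_locales
  have sets: "sets (?W \<Otimes>\<^sub>M ?X) = sets borel"
    by (intro sets_pair_borel) simp_all
  have setsX: "sets ?X = sets borel"
    by (intro sets_pair_borel) simp_all
  have hm: "h \<in> borel_measurable (?W \<Otimes>\<^sub>M ?X)"
    using h by (simp add: measurable_cong_sets[OF sets refl])
  have int: "integrable (?W \<Otimes>\<^sub>M ?X) h"
    by (rule WX.integrable_const_bound[of _ B]) (use bound hm in auto)
  have intX: "(\<integral>x. h (w, x) \<partial>?X) = (\<integral>y. \<integral>x. h (w, y, x) \<partial>exp_law l \<partial>exp_law m)" for w
  proof (rule X.integral_fst'[of "\<lambda>x. h (w, x)", symmetric])
    have "(\<lambda>x. h (w, x)) \<in> borel_measurable borel" by measurable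
    thus "integrable ?X (\<lambda>x. h (w, x))"
      by (intro X.integrable_const_bound[of _ B])
         (use bound in \<open>auto simp: measurable_cong_sets[OF setsX refl]\<close>)
  qed
  have gm: "(\<lambda>w. \<integral>x. h (w, x) \<partial>?X) \<in> borel_measurable borel"
  proof -
    have "(\<lambda>w. \<integral>x. h (w, x) \<partial>?X) \<in> borel_measurable ?W"
      using hm by (intro X.borel_measurable_lebesgue_integral) simp
    thus ?thesis by simp
  qed
  have "(\<integral>\<omega>. indicator (E \<inter> F) \<omega> *\<^sub>R h (W \<omega>, S \<omega>, A \<omega>) \<partial>M)
      = (\<integral>u. h u \<partial>distr (density M (\<lambda>\<omega>. ennreal (indicator (E \<inter> F) \<omega>))) borel (\<lambda>\<omega>. (W \<omega>, S \<omega>, A \<omega>)))"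
    by (subst integral_distr, measurable, subst integral_density) auto
  also have "\<dots> = (\<integral>u. h u \<partial>density (?W \<Otimes>\<^sub>M ?X) (\<lambda>_. ennreal p))"
    by (subst joint_law_on_transition[OF assms(1-10)]) auto
  also have "\<dots> = p *\<^sub>R (\<integral>u. h u \<partial>(?W \<Otimes>\<^sub>M ?X))"
    by (subst integral_density) (use hm p in auto)
  also have "(\<integral>u. h u \<partial>(?W \<Otimes>\<^sub>M ?X)) = (\<integral>w. \<integral>x. h (w, x) \<partial>?X \<partial>?W)"
    using WX.integral_fst'[OF int] by simp
  also have "\<dots> = (\<integral>\<omega>. indicator E \<omega> *\<^sub>R (\<integral>x. h (W \<omega>, x) \<partial>?X) \<partial>M)"
    using gm by (subst integral_distr, measurable, subst integral_density) auto
  finally show ?thesis unfolding intX .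
qed

section \<open>One step of the waiting time process\<close>

lemma integral_diff_mult:
  fixes f g :: "'a \<Rightarrow> complex"
  assumes "integrable M f" "integrable M g"
  shows "(\<integral>x. a * f x - b * g x \<partial>M) = a * integral\<^sup>L M f - b * integral\<^sup>L M g"
  using assms by simp

text \<open>The function \<open>k z\<close> below is the transform at \<open>z\<close> of the sojourn time of a customer with waiting time
  \<open>w\<close>, and \<open>T z m c E\<close> is the integral of \<open>k z (W \<omega>)\<close> over \<open>E\<close>. The two exponential
  averages are taken in the order interarrival time, service time; the first one produces the
  arguments \<open>l\<close> and \<open>s\<close> at which the second is evaluated.\<close>

lemma transform_on_transition:
  fixes M :: "'a measure" and W S A :: "'a \<Rightarrow> real" and s :: complex
  defines "T \<equiv> \<lambda>z m c E. \<integral>\<omega>. indicator E \<omega> *\<^sub>R (exp (- z * of_real (W \<omega>))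
             - z / (of_real m + z) * exp (- (z + of_real (m * c)) * of_real (W \<omega>))) \<partial>M"
  assumes "prob_space M"
    and meas[measurable]: "W \<in> borel_measurable M" "S \<in> borel_measurable M" "A \<in> borel_measurable M"
      "E \<in> sets M" "F \<in> sets M"
    and p: "p \<ge> 0" and m: "m > 0" and l: "l > 0"
    and law: "\<And>w y x. y \<ge> 0 \<Longrightarrow> x \<ge> 0 \<Longrightarrow>
        measure M {\<omega> \<in> space M. \<omega> \<in> E \<and> \<omega> \<in> F \<and> W \<omega> \<le> w \<and> S \<omega> \<le> y \<and> A \<omega> \<le> x}
          = measure M {\<omega> \<in> space M. \<omega> \<in> E \<and> W \<omega> \<le> w} * (p * (1 - exp (- m * y)) * (1 - exp (- l * x)))"
    and W0: "\<And>\<omega>. \<omega> \<in> space M \<Longrightarrow> W \<omega> \<ge> 0" and c: "c > 0" and s: "Re s \<ge> 0"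
  shows "(s - of_real l) * (\<integral>\<omega>. indicator (E \<inter> F) \<omega> *\<^sub>R
             exp (- s * of_real (max 0 (W \<omega> + max 0 (S \<omega> - c * W \<omega>) - A \<omega>))) \<partial>M)
       = of_real p * (s * T (of_real l) m c E - of_real l * T s m c E)"
proof -
  interpret prob_space M by fact
  interpret Pm: prob_space "exp_law m" using m by (rule prob_space_exponential_density)
  define h where "h = (\<lambda>(w, y, x). exp (- s * complex_of_real (max 0 (w + max 0 (y - c * w) - x))))"
  define k where "k = (\<lambda>z w. exp (- z * complex_of_real w)
     - z / (of_real m + z) * exp (- (z + of_real (m * c)) * complex_of_real w))"
  have h_meas: "h \<in> borel_measurable borel"
    unfolding h_def borel_prod[symmetric] by measurable
  have h_bound: "norm (h u) \<le> 1" for u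
    using s by (cases u) (simp add: h_def norm_exp_eq_Re)
  have sojourn: "(\<integral>y. exp (- z * complex_of_real (w + max 0 (y - c * w))) \<partial>exp_law m) = k z w"
    if z: "Re z \<ge> 0" and w: "w \<ge> 0" for z w
  proof -
    have "(\<integral>y. exp (- z * complex_of_real (w + max 0 (y - c * w))) \<partial>exp_law m)
        = (\<integral>y. exp (- z * of_real w) * exp (- z * complex_of_real (max 0 (y - c * w))) \<partial>exp_law m)"
      by (intro Bochner_Integration.integral_cong refl) (simp add: algebra_simps flip: exp_add)
    also have "\<dots> = exp (- z * of_real w) * (1 - z / (of_real m + z) * exp (- of_real (m * (c * w))))"
      using w c by (subst integral_mult_right_zero, subst service_transform[OF m z]) auto
    also have "\<dots> = k z w"
      by (simp add: k_def algebra_simps flip: exp_add)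
    finally show ?thesis .
  qed
  have int_y: "integrable (exp_law m) (\<lambda>y. exp (- z * complex_of_real (w + max 0 (y - c * w))))"
    if "Re z \<ge> 0" "w \<ge> 0" for z w
    using that by (intro Pm.integrable_const_bound[of _ 1]) (auto simp: norm_exp_eq_Re)
  have step: "(s - of_real l) * (\<integral>y. \<integral>x. h (w, y, x) \<partial>exp_law l \<partial>exp_law m)
      = s * k (of_real l) w - of_real l * k s w" if w: "w \<ge> 0" for w
  proof -
    have "(s - of_real l) * (\<integral>y. \<integral>x. h (w, y, x) \<partial>exp_law l \<partial>exp_law m)
        = (\<integral>y. (s - of_real l) * (\<integral>x. h (w, y, x) \<partial>exp_law l) \<partial>exp_law m)"
      by (rule integral_mult_right_zero[symmetric])
    also have "\<dots> = (\<integral>y. s * exp (- of_real l * complex_of_real (w + max 0 (y - c * w)))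
        - of_real l * exp (- s * complex_of_real (w + max 0 (y - c * w))) \<partial>exp_law m)"
    proof (intro Bochner_Integration.integral_cong refl)
      fix y :: real
      have "w + max 0 (y - c * w) \<ge> 0" using w by auto
      from interarrival_transform[OF l this, of s]
      show "(s - of_real l) * (\<integral>x. h (w, y, x) \<partial>exp_law l)
         = s * exp (- of_real l * complex_of_real (w + max 0 (y - c * w)))
           - of_real l * exp (- s * complex_of_real (w + max 0 (y - c * w)))"
        by (simp add: h_def)
    qed
    also have "\<dots> = s * k (of_real l) w - of_real l * k s w"
      using l s w by (subst integral_diff_mult, (intro int_y; simp)+) (simp only: sojourn Re_complex_of_real less_imp_le)
    finally show ?thesis .
  qed
  have int_k: "integrable M (\<lambda>\<omega>. indicator E \<omega> *\<^sub>R k z (W \<omega>))" if z: "Re z \<ge> 0" for z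
  proof -
    have "integrable M (\<lambda>\<omega>. exp (- u * complex_of_real (W \<omega>)))" if "Re u \<ge> 0" for u
      using that W0 by (intro integrable_const_bound[of _ 1]) (auto simp: norm_exp_eq_Re intro!: AE_I2)
    from this[OF z] this[of "z + of_real (m * c)"] have "integrable M (\<lambda>\<omega>. k z (W \<omega>))"
      unfolding k_def using z m c by (intro Bochner_Integration.integrable_diff integrable_mult_right) simp_all
    thus ?thesis by (intro integrable_mult_indicator) auto
  qed
  have "(s - of_real l) * (\<integral>\<omega>. indicator (E \<inter> F) \<omega> *\<^sub>R h (W \<omega>, S \<omega>, A \<omega>) \<partial>M)
      = (s - of_real l) * (p *\<^sub>R (\<integral>\<omega>. indicator E \<omega> *\<^sub>R (\<integral>y. \<integral>x. h (W \<omega>, y, x) \<partial>exp_law l \<partial>exp_law m) \<partial>M))"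
    by (subst integral_on_transition[OF \<open>prob_space M\<close> meas p m l law h_meas h_bound]) auto
  also have "\<dots> = p *\<^sub>R (\<integral>\<omega>. (s - of_real l) * (indicator E \<omega> *\<^sub>R (\<integral>y. \<integral>x. h (W \<omega>, y, x) \<partial>exp_law l \<partial>exp_law m)) \<partial>M)"
    by (subst integral_mult_right_zero) (rule mult_scaleR_right)
  also have "(\<integral>\<omega>. (s - of_real l) * (indicator E \<omega> *\<^sub>R (\<integral>y. \<integral>x. h (W \<omega>, y, x) \<partial>exp_law l \<partial>exp_law m)) \<partial>M)
      = (\<integral>\<omega>. s * (indicator E \<omega> *\<^sub>R k (of_real l) (W \<omega>)) - of_real l * (indicator E \<omega> *\<^sub>R k s (W \<omega>)) \<partial>M)"
    using step W0
    by (intro Bochner_Integration.integral_cong refl) (auto simp: indicator_def)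
  also have "\<dots> = s * T (of_real l) m c E - of_real l * T s m c E"
    unfolding T_def k_def using l s by (intro integral_diff_mult int_k[unfolded k_def]) auto
  finally show ?thesis
    by (simp add: h_def scaleR_conv_of_real)
qed

text \<open>Here the conditional independence of the step from the past enters, with \<open>W n \<le> w\<close> as the past
  event. If \<open>Y n = i\<close> has probability zero, both sides vanish.\<close>

lemma transition_law:
  fixes M :: "'a measure" and W A S :: "nat \<Rightarrow> 'a \<Rightarrow> real" and Y :: "nat \<Rightarrow> 'a \<Rightarrow> 'n::finite"
  assumes "prob_space M"
    and meas[measurable]: "W n \<in> borel_measurable M" "A (Suc n) \<in> borel_measurable M"
      "S n \<in> borel_measurable M" "Y n \<in> measurable M (count_space UNIV)"
      "Y (Suc n) \<in> measurable M (count_space UNIV)"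
    and indep: "step_indep_of_past M W A S Y"
    and law: "\<P>(\<omega> in M. Y n \<omega> = i) > 0 \<Longrightarrow>
           \<P>(\<omega> in M. A (Suc n) \<omega> \<le> x \<and> S n \<omega> \<le> y \<and> Y (Suc n) \<omega> = j \<bar> Y n \<omega> = i) = r"
  shows "measure M {\<omega> \<in> space M. Y n \<omega> = i \<and> Y (Suc n) \<omega> = j \<and> W n \<omega> \<le> w \<and> S n \<omega> \<le> y \<and> A (Suc n) \<omega> \<le> x}
          = measure M {\<omega> \<in> space M. Y n \<omega> = i \<and> W n \<omega> \<le> w} * r"
proof -
  interpret prob_space M by fact
  let ?E = "{\<omega> \<in> space M. Y n \<omega> = i}"
  let ?a = "{\<omega> \<in> space M. W n \<omega> \<le> w}"
  let ?b = "{\<omega> \<in> space M. A (Suc n) \<omega> \<le> x \<and> S n \<omega> \<le> y \<and> Y (Suc n) \<omega> = j}"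
  have eq: "{\<omega> \<in> space M. Y n \<omega> = i \<and> Y (Suc n) \<omega> = j \<and> W n \<omega> \<le> w \<and> S n \<omega> \<le> y \<and> A (Suc n) \<omega> \<le> x}
      = ?E \<inter> (?a \<inter> ?b)" "{\<omega> \<in> space M. Y n \<omega> = i \<and> W n \<omega> \<le> w} = ?E \<inter> ?a"
    by auto
  show ?thesis
  proof (cases "measure M ?E > 0")
    case False
    hence E0: "measure M ?E = 0" by (simp add: not_less measure_le_0_iff)
    have "measure M (?E \<inter> B) = 0" for B
      using finite_measure_mono[of "?E \<inter> B" ?E] E0 by (simp add: measure_le_0_iff)
    thus ?thesis unfolding eq by simp
  next
    case True
    hence E: "emeasure M ?E \<noteq> 0" "emeasure M ?E \<noteq> \<infinity>" by (auto simp: emeasure_eq_measure)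
    let ?N = "uniform_measure M ?E"
    interpret N: prob_space ?N using E by (rule prob_space_uniform_measure)
    have "?a = W n -` {..w} \<inter> space M" by auto
    hence "?a \<in> past_events M W A S Y n"
      unfolding past_events_def
      by (intro sigma_sets.Basic UnI1 CollectI exI[of _ n] exI[of _ "{..w}"] conjI) auto
    moreover have "?b \<in> step_events M A S Y n"
    proof -
      have "{..x} \<times> ({..y} \<times> {j}) \<in> sets (borel \<Otimes>\<^sub>M borel \<Otimes>\<^sub>M count_space UNIV)"
        by (intro pair_measureI) auto
      moreover have "?b = (\<lambda>\<omega>. (A (Suc n) \<omega>, S n \<omega>, Y (Suc n) \<omega>)) -` ({..x} \<times> ({..y} \<times> {j})) \<inter> space M"
        by auto
      ultimately show ?thesis unfolding step_events_def by blast
    qed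
    ultimately have "measure ?N (?a \<inter> ?b) = measure ?N ?a * measure ?N ?b"
      using indep True unfolding step_indep_of_past_def by (intro N.indep_setD) auto
    hence "measure M (?E \<inter> (?a \<inter> ?b)) / measure M ?E
        = measure M (?E \<inter> ?a) / measure M ?E * (measure M (?E \<inter> ?b) / measure M ?E)"
      using E by simp
    moreover have "measure M (?E \<inter> ?b) / measure M ?E = r"
    proof -
      have "?E \<inter> ?b = {\<omega> \<in> space M. (A (Suc n) \<omega> \<le> x \<and> S n \<omega> \<le> y \<and> Y (Suc n) \<omega> = j) \<and> Y n \<omega> = i}"
        by auto
      thus ?thesis using law[OF True] by (simp add: cond_prob_def)
    qed
    ultimately show ?thesis unfolding eq using True by (simp add: field_simps)
  qed
qed

text \<open>The event \<open>Y (Suc n) = j\<close> is split according to the predecessor state \<open>i\<close>, and on each piece the law of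
  the transition applies. The term \<open>T n i z\<close> is the transform of the \<open>n\<close>th sojourn time on \<open>Y n = i\<close>.\<close>

lemma joint_transform_step:
  fixes M :: "'a measure" and W A S :: "nat \<Rightarrow> 'a \<Rightarrow> real" and Y :: "nat \<Rightarrow> 'a \<Rightarrow> 'n::finite"
    and P :: "real ^ 'n ^ 'n" and lam :: "real ^ 'n" and mu c :: real and s :: complex
  defines "T \<equiv> \<lambda>n i z. joint_transform M (W n) (Y n) i z
      - z / (of_real mu + z) * joint_transform M (W n) (Y n) i (z + of_real (mu * c))"
  assumes "prob_space M" and c: "c > 0" and mu: "mu > 0" and lam: "lam $ j > 0"
    and P: "\<And>i. P $ i $ j \<ge> 0"
    and W: "\<And>n. W n \<in> borel_measurable M"
    and A: "\<And>n. A (Suc n) \<in> borel_measurable M"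
    and S: "\<And>n. S n \<in> borel_measurable M"
    and Y: "\<And>n. Y n \<in> measurable M (count_space UNIV)"
    and W0: "\<And>n \<omega>. \<omega> \<in> space M \<Longrightarrow> W n \<omega> \<ge> 0"
    and rec: "\<And>n \<omega>. \<omega> \<in> space M \<Longrightarrow>
           W (Suc n) \<omega> = max 0 (W n \<omega> + max 0 (S n \<omega> - c * W n \<omega>) - A (Suc n) \<omega>)"
    and indep: "step_indep_of_past M W A S Y"
    and law: "\<And>n i x y. \<P>(\<omega> in M. Y n \<omega> = i) > 0 \<Longrightarrow> x \<ge> 0 \<Longrightarrow> y \<ge> 0 \<Longrightarrow>
           \<P>(\<omega> in M. A (Suc n) \<omega> \<le> x \<and> S n \<omega> \<le> y \<and> Y (Suc n) \<omega> = j \<bar> Y n \<omega> = i)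
             = P $ i $ j * (1 - exp (- mu * y)) * (1 - exp (- (lam $ j) * x))"
    and s: "Re s \<ge> 0"
  shows "(s - of_real (lam $ j)) * joint_transform M (W (Suc n)) (Y (Suc n)) j s
      = (\<Sum>i\<in>UNIV. of_real (P $ i $ j) *
           (s * T n i (of_real (lam $ j)) - of_real (lam $ j) * T n i s))"
proof -
  interpret prob_space M by fact
  note [measurable] = W A S Y
  define E where "E = (\<lambda>i. {\<omega> \<in> space M. Y n \<omega> = i})"
  define F where "F = {\<omega> \<in> space M. Y (Suc n) \<omega> = j}"
  have EF[measurable]: "E i \<in> sets M" "F \<in> sets M" for i unfolding E_def F_def by measurable
  let ?h = "\<lambda>\<omega>. exp (- s * complex_of_real (max 0 (W n \<omega> + max 0 (S n \<omega> - c * W n \<omega>) - A (Suc n) \<omega>)))"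
  have int_exp: "integrable M (\<lambda>\<omega>. indicator (E i) \<omega> *\<^sub>R exp (- z * complex_of_real (W n \<omega>)))"
    if "Re z \<ge> 0" for z i
    using that W0
    by (intro integrable_const_bound[of _ 1]) (auto simp: norm_exp_eq_Re indicator_def intro!: AE_I2)
  have J: "joint_transform M (W n) (Y n) i z
      = (\<integral>\<omega>. indicator (E i) \<omega> *\<^sub>R exp (- z * complex_of_real (W n \<omega>)) \<partial>M)" for i z
    unfolding joint_transform_def
    by (intro Bochner_Integration.integral_cong refl) (auto simp: E_def)
  have T: "(\<integral>\<omega>. indicator (E i) \<omega> *\<^sub>R (exp (- z * of_real (W n \<omega>))
             - z / (of_real mu + z) * exp (- (z + of_real (mu * c)) * of_real (W n \<omega>))) \<partial>M) = T n i z"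
    if "Re z \<ge> 0" for z i
  proof -
    have "T n i z = (\<integral>\<omega>. 1 * (indicator (E i) \<omega> *\<^sub>R exp (- z * of_real (W n \<omega>)))
        - z / (of_real mu + z) * (indicator (E i) \<omega> *\<^sub>R exp (- (z + of_real (mu * c)) * of_real (W n \<omega>))) \<partial>M)"
      unfolding T_def J using that mu c
      by (subst integral_diff_mult, (intro int_exp; simp)+) (simp only: mult_1)
    also have "\<dots> = (\<integral>\<omega>. indicator (E i) \<omega> *\<^sub>R (exp (- z * of_real (W n \<omega>))
             - z / (of_real mu + z) * exp (- (z + of_real (mu * c)) * of_real (W n \<omega>))) \<partial>M)"
      by (intro Bochner_Integration.integral_cong refl) (simp only: scaleR_diff_right mult_scaleR_right mult_1)
    finally show ?thesis ..
  qed
  have "joint_transform M (W (Suc n)) (Y (Suc n)) j s = (\<integral>\<omega>. (\<Sum>i\<in>UNIV. indicator (E i \<inter> F) \<omega> *\<^sub>R ?h \<omega>) \<partial>M)"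
    unfolding joint_transform_def
  proof (intro Bochner_Integration.integral_cong refl)
    fix \<omega> assume w: "\<omega> \<in> space M"
    have "(\<Sum>i\<in>UNIV. indicator (E i \<inter> F) \<omega> *\<^sub>R ?h \<omega>) = (\<Sum>i\<in>UNIV. if i = Y n \<omega> then indicator F \<omega> *\<^sub>R ?h \<omega> else 0)"
      using w by (intro sum.cong) (auto simp: E_def indicator_def)
    thus "exp (- s * complex_of_real (W (Suc n) \<omega>)) * of_bool (Y (Suc n) \<omega> = j)
        = (\<Sum>i\<in>UNIV. indicator (E i \<inter> F) \<omega> *\<^sub>R ?h \<omega>)"
      using w rec[OF w, of n] by (simp add: F_def indicator_def)
  qed
  also have "\<dots> = (\<Sum>i\<in>UNIV. \<integral>\<omega>. indicator (E i \<inter> F) \<omega> *\<^sub>R ?h \<omega> \<partial>M)"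
    using s by (intro Bochner_Integration.integral_sum integrable_const_bound[of _ 1])
      (auto simp: norm_exp_eq_Re indicator_def intro!: AE_I2)
  finally have "(s - of_real (lam $ j)) * joint_transform M (W (Suc n)) (Y (Suc n)) j s
     = (\<Sum>i\<in>UNIV. (s - of_real (lam $ j)) * (\<integral>\<omega>. indicator (E i \<inter> F) \<omega> *\<^sub>R ?h \<omega> \<partial>M))"
    by (simp add: sum_distrib_left)
  also have "\<dots> = (\<Sum>i\<in>UNIV. of_real (P $ i $ j) *
           (s * T n i (of_real (lam $ j)) - of_real (lam $ j) * T n i s))"
  proof (intro sum.cong refl)
    fix i
    have eqs: "{\<omega> \<in> space M. \<omega> \<in> E i \<and> \<omega> \<in> F \<and> W n \<omega> \<le> w \<and> S n \<omega> \<le> y \<and> A (Suc n) \<omega> \<le> x}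
        = {\<omega> \<in> space M. Y n \<omega> = i \<and> Y (Suc n) \<omega> = j \<and> W n \<omega> \<le> w \<and> S n \<omega> \<le> y \<and> A (Suc n) \<omega> \<le> x}"
      "{\<omega> \<in> space M. \<omega> \<in> E i \<and> W n \<omega> \<le> w} = {\<omega> \<in> space M. Y n \<omega> = i \<and> W n \<omega> \<le> w}" for w y x
      by (auto simp: E_def F_def)
    have "measure M {\<omega> \<in> space M. \<omega> \<in> E i \<and> \<omega> \<in> F \<and> W n \<omega> \<le> w \<and> S n \<omega> \<le> y \<and> A (Suc n) \<omega> \<le> x}
       = measure M {\<omega> \<in> space M. \<omega> \<in> E i \<and> W n \<omega> \<le> w}
         * (P $ i $ j * (1 - exp (- mu * y)) * (1 - exp (- (lam $ j) * x)))"
      if "y \<ge> 0" "x \<ge> 0" for w y x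
      unfolding eqs
      by (rule transition_law[OF \<open>prob_space M\<close> W A S Y Y indep law[OF _ that(2,1)]])
    from transform_on_transition[OF \<open>prob_space M\<close> W S A EF P mu lam this W0 c s]
    show "(s - of_real (lam $ j)) * (\<integral>\<omega>. indicator (E i \<inter> F) \<omega> *\<^sub>R ?h \<omega> \<partial>M)
       = of_real (P $ i $ j) * (s * T n i (of_real (lam $ j)) - of_real (lam $ j) * T n i s)"
      using lam s by (simp only: T Re_complex_of_real less_imp_le)
  qed
  finally show ?thesis .
qed

lemma norm_joint_transform_le:
  assumes "prob_space M" "\<And>\<omega>. \<omega> \<in> space M \<Longrightarrow> X \<omega> \<ge> 0" "Re s \<ge> 0"
  shows "norm (joint_transform M X U i s) \<le> 1"
proof -
  interpret prob_space M by fact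
  have "norm (joint_transform M X U i s)
      \<le> (\<integral>\<omega>. norm (exp (- s * complex_of_real (X \<omega>)) * of_bool (U \<omega> = i)) \<partial>M)"
    unfolding joint_transform_def by (rule integral_norm_bound)
  also have "\<dots> \<le> (\<integral>\<omega>. 1 \<partial>M)"
    using assms by (intro Bochner_Integration.integral_mono') (auto simp: norm_mult norm_exp_eq_Re)
  finally show ?thesis by (simp add: prob_space)
qed

section \<open>Solving the matrix recursion\<close>

lemma scale_mat_mult_vec: "scale_mat a B *v x = a *s (B *v x)"
  by (simp add: vec_eq_iff scale_mat_def matrix_vector_mult_def sum_distrib_left mult.assoc)

lemma Lambda_mat_mult_vec: "(Lambda_mat lam *v x) $ j = of_real (lam $ j) * x $ j"
  by (simp add: Lambda_mat_def matrix_vector_mult_def if_distrib[of "\<lambda>u. u * _"] cong: if_cong)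

lemma transpose_cmatrix_mult_vec:
  "(transpose (cmatrix P) *v x) $ j = (\<Sum>i\<in>UNIV. of_real (P $ i $ j) * x $ i)"
  by (simp add: cmatrix_def transpose_def matrix_vector_mult_def)

lemma D_mat_mult_vec:
  "D_mat P lam z *v x = z *s x - (Lambda_mat lam ** (mat 1 - transpose (cmatrix P))) *v x"
  by (simp add: D_mat_def matrix_vector_mult_diff_rdistrib scale_mat_mult_vec)

lemma
  assumes "det (D_mat P lam z) \<noteq> 0"
  shows D_mat_A_mat: "D_mat P lam z *v (A_mat P lam z *v y) = z *s y"
    and A_mat_unique: "D_mat P lam z *v x = z *s y \<Longrightarrow> x = A_mat P lam z *v y"
proof -
  let ?D = "D_mat P lam z"
  have "\<exists>B. ?D ** B = mat 1 \<and> B ** ?D = mat 1"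
    using assms by (simp add: invertible_def flip: invertible_det_nz)
  hence inv: "?D ** matrix_inv ?D = mat 1" "matrix_inv ?D ** ?D = mat 1"
    unfolding matrix_inv_def by (metis (mono_tags, lifting) someI_ex)+
  show "?D *v (A_mat P lam z *v y) = z *s y"
    by (simp add: A_mat_def scale_mat_mult_vec vector_scalar_commute matrix_vector_mul_assoc inv)
  assume "?D *v x = z *s y"
  hence "matrix_inv ?D *v (?D *v x) = z *s (matrix_inv ?D *v y)"
    by (simp add: vector_scalar_commute)
  thus "x = A_mat P lam z *v y"
    by (simp add: A_mat_def scale_mat_mult_vec matrix_vector_mul_assoc inv)
qed

lemma norm_scalar_mult_vec: "norm (a *s (x :: complex ^ 'n)) = norm a * norm x"
  by (simp add: norm_vec_def vector_scalar_mult_def norm_mult L2_set_right_distrib)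

text \<open>The bound is read off the equation that the inverse solves: \<open>x = A(z) y\<close> satisfies \<open>z x = z y + G x\<close> with the constant
  matrix \<open>G = \<Lambda> (I - P\<^sup>T)\<close>, and for \<open>|z|\<close> at least twice the norm of \<open>G\<close> the last term is absorbed into
  the left-hand side.\<close>

lemma norm_A_mat_mult_le:
  fixes P :: "real ^ 'n ^ 'n"
  obtains B where "B > 0" "\<And>z y. det (D_mat P lam z) \<noteq> 0 \<Longrightarrow> norm z \<ge> B \<Longrightarrow>
    norm (A_mat P lam z *v y) \<le> 2 * norm y"
proof -
  let ?G = "Lambda_mat lam ** (mat 1 - transpose (cmatrix P))"
  obtain K where K: "K > 0" "\<And>x. norm (?G *v x) \<le> norm x * K"
    using bounded_linear.pos_bounded[OF matrix_vector_mul_bounded_linear[of ?G]] by auto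
  show ?thesis
  proof (rule that[of "2 * K"])
    fix z y assume det: "det (D_mat P lam z) \<noteq> 0" and z: "norm z \<ge> 2 * K"
    define x where "x = A_mat P lam z *v y"
    have "z *s x = z *s y + ?G *v x"
      using D_mat_A_mat[OF det, of y] by (simp add: x_def D_mat_mult_vec algebra_simps)
    hence "norm z * norm x \<le> norm z * norm y + norm x * K"
      using norm_triangle_ineq[of "z *s y" "?G *v x"] K(2)[of x] norm_scalar_mult_vec[of z x]
      by (simp add: norm_scalar_mult_vec)
    moreover have "norm x * K \<le> norm x * (norm z / 2)"
      using z by (intro mult_left_mono) auto
    ultimately have "norm z * norm x \<le> norm z * (2 * norm y)"
      by (simp add: algebra_simps)
    moreover have "norm z > 0" using z K by linarith
    ultimately show "norm (A_mat P lam z *v y) \<le> 2 * norm y"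
      unfolding x_def by (rule mult_left_le_imp_le)
  qed (use K in simp)
qed

lemma eventually_norm_M_mat_le:
  fixes P :: "real ^ 'n ^ 'n"
  assumes h: "h > 0" and mu: "mu > 0" and s: "Re s \<ge> 0"
    and det: "\<And>l::nat. det (D_mat P lam (s + of_nat l * of_real h)) \<noteq> 0"
  shows "\<forall>\<^sub>F l in sequentially. \<forall>y.
    norm (M_mat P lam mu (s + of_nat l * of_real h) *v y) \<le> norm y / 2"
proof -
  let ?R = "Lambda_mat lam ** transpose (cmatrix P)"
  obtain B where B: "B > 0" "\<And>z y. det (D_mat P lam z) \<noteq> 0 \<Longrightarrow> norm z \<ge> B \<Longrightarrow>
    norm (A_mat P lam z *v y) \<le> 2 * norm y"
    by (rule norm_A_mat_mult_le[of P lam]) (rule that)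
  obtain C where C: "C > 0" "\<And>x. norm (?R *v x) \<le> norm x * C"
    using bounded_linear.pos_bounded[OF matrix_vector_mul_bounded_linear[of ?R]] by auto
  have "filterlim (\<lambda>l. real l * h) at_top sequentially"
    using h by real_asymp
  hence "\<forall>\<^sub>F l in sequentially. real l * h \<ge> max B (4 * C)"
    unfolding filterlim_at_top by blast
  thus ?thesis
  proof eventually_elim
    case (elim l)
    define z where "z = s + of_nat l * of_real h"
    have Rez: "Re z \<ge> B" "Re z \<ge> 4 * C" using elim s by (auto simp: z_def)
    have z: "norm z \<ge> B" using Rez complex_Re_le_cmod[of z] by linarith
    have muz: "norm (of_real mu + z) \<ge> 4 * C" using Rez mu complex_Re_le_cmod[of "of_real mu + z"] by simp
    show ?case
    proof
      fix y :: "complex ^ 'n"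
      have "M_mat P lam mu z *v y = (1 / (of_real mu + z)) *s (A_mat P lam z *v (?R *v y))"
        by (simp add: M_mat_def scale_mat_mult_vec matrix_vector_mul_assoc matrix_mul_assoc)
      hence "norm (M_mat P lam mu z *v y) = norm (A_mat P lam z *v (?R *v y)) / norm (of_real mu + z)"
        by (simp add: norm_scalar_mult_vec norm_divide)
      also have "\<dots> \<le> (2 * (norm y * C)) / (4 * C)"
        using B(2)[of z "?R *v y"] C det[of l] z muz
        by (intro frac_le) (auto simp: z_def[symmetric] intro: order_trans[OF _ mult_left_mono])
      also have "\<dots> = norm y / 2" using C by simp
      finally show "norm (M_mat P lam mu (s + of_nat l * of_real h) *v y) \<le> norm y / 2"
        by (simp add: z_def)
    qed
  qed
qed

text \<open>The first \<open>L\<close> factors, which need not contract, act through one bounded linear map; each later factor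
  halves the norm of the vector it is applied to.\<close>

lemma ordered_prod_mult_tendsto_zero:
  fixes F :: "nat \<Rightarrow> complex ^ 'n ^ 'n"
  assumes F: "\<forall>\<^sub>F l in sequentially. \<forall>y. norm (F l *v y) \<le> norm y / 2"
    and z: "\<And>k. norm (z k) \<le> B"
  shows "(\<lambda>k. ordered_prod F k *v z k) \<longlonglongrightarrow> 0"
proof -
  obtain L where L: "\<And>l y. l \<ge> L \<Longrightarrow> norm (F l *v y) \<le> norm y / 2"
    using F by (auto simp: eventually_sequentially)
  obtain C where C: "C > 0" "\<And>x. norm (ordered_prod F L *v x) \<le> norm x * C"
    using bounded_linear.pos_bounded[OF matrix_vector_mul_bounded_linear[of "ordered_prod F L"]] by auto
  have bound: "norm (ordered_prod F (k + L) *v x) \<le> C * norm x * (1 / 2) ^ k" for k x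
  proof (induction k arbitrary: x)
    case 0
    show ?case using C(2)[of x] by (simp add: mult.commute)
  next
    case (Suc k)
    have "norm (ordered_prod F (Suc k + L) *v x) = norm (ordered_prod F (k + L) *v (F (k + L) *v x))"
      by (simp add: matrix_vector_mul_assoc)
    also have "\<dots> \<le> C * norm (F (k + L) *v x) * (1 / 2) ^ k" by (rule Suc.IH)
    also have "\<dots> \<le> C * (norm x / 2) * (1 / 2) ^ k"
      using C L[of "k + L" x] by (intro mult_right_mono mult_left_mono) auto
    finally show ?case by simp
  qed
  have "(\<lambda>k. ordered_prod F (k + L) *v z (k + L)) \<longlonglongrightarrow> 0"
  proof (rule Lim_null_comparison)
    show "\<forall>\<^sub>F k in sequentially. norm (ordered_prod F (k + L) *v z (k + L)) \<le> C * B * (1 / 2) ^ k"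
    proof (intro always_eventually allI)
      fix k
      have "C * norm (z (k + L)) * (1 / 2) ^ k \<le> C * B * (1 / 2) ^ k"
        using C z by (intro mult_right_mono mult_left_mono) auto
      with bound[of k "z (k + L)"]
      show "norm (ordered_prod F (k + L) *v z (k + L)) \<le> C * B * (1 / 2) ^ k" by linarith
    qed
    show "(\<lambda>k. C * B * (1 / 2) ^ k) \<longlonglongrightarrow> 0"
      by (intro tendsto_mult_right_zero LIMSEQ_power_zero) simp
  qed
  thus ?thesis by (rule LIMSEQ_offset)
qed

text \<open>By induction, \<open>K\<close> applications of the recursion express \<open>z 0\<close> as the \<open>K\<close>th partial sum plus the
  remainder \<open>ordered_prod F K *v z K\<close>.\<close>

lemma sums_ordered_prod_if_recursion:
  fixes F G :: "nat \<Rightarrow> complex ^ 'n ^ 'n"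
  assumes rec: "\<And>k. z k = G k *v v + F k *v z (Suc k)"
    and lim: "(\<lambda>k. ordered_prod F k *v z k) \<longlonglongrightarrow> 0"
  shows "(\<lambda>k. (ordered_prod F k ** G k) *v v) sums z 0"
proof -
  have "z 0 - ordered_prod F K *v z K = (\<Sum>k<K. (ordered_prod F k ** G k) *v v)" for K
  proof (induction K)
    case (Suc K)
    have "ordered_prod F K *v z K
        = (ordered_prod F K ** G K) *v v + ordered_prod F (Suc K) *v z (Suc K)"
      by (subst rec) (simp add: matrix_vector_right_distrib matrix_vector_mul_assoc)
    with Suc.IH show ?case by (simp add: algebra_simps)
  qed simp
  moreover have "(\<lambda>K. z 0 - ordered_prod F K *v z K) \<longlonglongrightarrow> z 0 - 0"
    by (intro tendsto_intros lim)
  ultimately show ?thesis by (simp add: sums_def)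
qed

section \<open>The series representation\<close>

theorem mainTheorem11:
  fixes M :: "'a measure" and M' :: "'b measure"
    and W A S :: "nat \<Rightarrow> 'a \<Rightarrow> real" and Y :: "nat \<Rightarrow> 'a \<Rightarrow> 'n::finite"
    and W' :: "'b \<Rightarrow> real" and Y' :: "'b \<Rightarrow> 'n"
    and P :: "real ^ 'n ^ 'n" and q lam :: "real ^ 'n" and c mu :: real and s :: complex
  assumes "c > 0" and "mu > 0" and "\<And>j. lam $ j > 0"
    and "stochastic_matrix P" and "irreducible_matrix P" and "stationary_distribution q P"
    and "prob_space M"
    and "\<And>n. W n \<in> borel_measurable M"
    and "\<And>n. A (Suc n) \<in> borel_measurable M"
    and "\<And>n. S n \<in> borel_measurable M"
    and "markov_chain M Y P"
    and "\<And>n \<omega>. \<omega> \<in> space M \<Longrightarrow> W n \<omega> \<ge> 0"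
    and "\<And>n \<omega>. \<omega> \<in> space M \<Longrightarrow>
           W (Suc n) \<omega> = max 0 (W n \<omega> + max 0 (S n \<omega> - c * W n \<omega>) - A (Suc n) \<omega>)"
    and "step_indep_of_past M W A S Y"
    and "\<And>n i j x y. \<P>(\<omega> in M. Y n \<omega> = i) > 0 \<Longrightarrow> x \<ge> 0 \<Longrightarrow> y \<ge> 0 \<Longrightarrow>
           \<P>(\<omega> in M. A (Suc n) \<omega> \<le> x \<and> S n \<omega> \<le> y \<and> Y (Suc n) \<omega> = j \<bar> Y n \<omega> = i)
             = P $ i $ j * (1 - exp (- mu * y)) * (1 - exp (- (lam $ j) * x))"
    and "prob_space M'"
    and "W' \<in> borel_measurable M'" and "Y' \<in> measurable M' (count_space UNIV)"
    and "\<And>\<omega>. \<omega> \<in> space M' \<Longrightarrow> W' \<omega> \<ge> 0"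
    and "\<And>i. \<P>(\<omega> in M'. Y' \<omega> = i) = q $ i"
    and "\<And>i z. Re z \<ge> 0 \<Longrightarrow>
           (\<lambda>n. joint_transform M (W n) (Y n) i z) \<longlonglongrightarrow> joint_transform M' W' Y' i z"
    and "Re s \<ge> 0"
    and "\<And>l::nat. det (D_mat P lam (s + of_nat l * of_real (mu * c))) \<noteq> 0"
  shows "(\<lambda>k. (ordered_prod (\<lambda>l. M_mat P lam mu (s + of_nat l * of_real (mu * c))) k
                 ** A_mat P lam (s + of_nat k * of_real (mu * c)))
               *v v_vec (Z_vec M W Y) P lam mu c)
         sums Z_vec M W Y s"
proof -
  note c = assms(1) and mu = assms(2) and lam = assms(3) and lim = assms(21)
    and s = assms(22) and det = assms(23)
  define Z where "Z = Z_vec M W Y"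
  define v where "v = v_vec Z P lam mu c"
  define h where "h = mu * c"
  define \<sigma> where "\<sigma> = (\<lambda>l::nat. s + of_nat l * of_real h)"
  have h: "h > 0" using mu c by (simp add: h_def)
  have Re\<sigma>: "Re (\<sigma> l) \<ge> 0" for l using s h by (simp add: \<sigma>_def)
  have Z_eq: "Z z $ i = joint_transform M' W' Y' i z" if "Re z \<ge> 0" for z i
    using limI[OF lim[OF that]] by (simp add: Z_def Z_vec_def)
  have Z_lim: "(\<lambda>n. joint_transform M (W n) (Y n) i z) \<longlonglongrightarrow> Z z $ i" if "Re z \<ge> 0" for z i
    using lim[OF that] Z_eq[OF that] by simp
  have Z_bound: "norm (Z z) \<le> real CARD('n)" if "Re z \<ge> 0" for z
  proof -
    have "norm (Z z) \<le> (\<Sum>i\<in>UNIV. norm (Z z $ i))"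
      by (simp add: norm_vec_def L2_set_le_sum)
    also have "\<dots> \<le> (\<Sum>i\<in>(UNIV :: 'n set). 1)"
      using norm_joint_transform_le[OF assms(16,19) that] by (intro sum_mono) (simp add: Z_eq[OF that])
    finally show ?thesis by simp
  qed
  have P: "P $ i $ j \<ge> 0" for i j
    using assms(4) by (simp add: stochastic_matrix_def)
  have Y: "Y n \<in> measurable M (count_space UNIV)" for n
    using assms(11) by (simp add: markov_chain_def)

  have rec: "Z z = A_mat P lam z *v v + M_mat P lam mu z *v Z (z + of_real h)"
    if z: "Re z \<ge> 0" and detz: "det (D_mat P lam z) \<noteq> 0" for z
  proof -
    define \<kappa> where "\<kappa> = z / (of_real mu + z)"
    have muz: "of_real mu + z \<noteq> 0" using z mu by (auto simp: complex_eq_iff)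
    have zh: "Re (z + of_real h) \<ge> 0" using z h by simp
    (* The scalar equations of the limit n \<rightarrow> \<infinity>, kept free of division by z - lam $ j. *)
    have bal: "(z - of_real (lam $ j)) * Z z $ j = z * v $ j
        - of_real (lam $ j) * (\<Sum>i\<in>UNIV. of_real (P $ i $ j) * (Z z $ i - \<kappa> * Z (z + of_real h) $ i))" for j
    proof -
      let ?l = "complex_of_real (lam $ j)"
      have l: "Re ?l \<ge> 0" "Re (?l + of_real (mu * c)) \<ge> 0"
        using lam[of j] h by (auto simp: h_def intro: less_imp_le)
      have zh': "Re (z + of_real (mu * c)) \<ge> 0" using zh by (simp only: h_def)
      let ?T = "\<lambda>n i u. joint_transform M (W n) (Y n) i u
          - u / (of_real mu + u) * joint_transform M (W n) (Y n) i (u + of_real (mu * c))"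
      have "(\<lambda>n. (z - ?l) * joint_transform M (W (Suc n)) (Y (Suc n)) j z) \<longlonglongrightarrow> (z - ?l) * Z z $ j"
        by (intro tendsto_intros LIMSEQ_Suc Z_lim z)
      moreover have "(z - ?l) * joint_transform M (W (Suc n)) (Y (Suc n)) j z
          = (\<Sum>i\<in>UNIV. of_real (P $ i $ j) * (z * ?T n i ?l - ?l * ?T n i z))" for n
        by (rule joint_transform_step[OF assms(7) c mu lam P assms(8-10) Y assms(12-15) z])
      moreover have "(\<lambda>n. \<Sum>i\<in>UNIV. of_real (P $ i $ j) * (z * ?T n i ?l - ?l * ?T n i z))
        \<longlonglongrightarrow> (\<Sum>i\<in>UNIV. of_real (P $ i $ j) *
           (z * (Z ?l $ i - ?l / (of_real mu + ?l) * Z (?l + of_real (mu * c)) $ i)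
            - ?l * (Z z $ i - \<kappa> * Z (z + of_real (mu * c)) $ i)))"
        unfolding \<kappa>_def by (intro tendsto_intros Z_lim z zh' l)
      ultimately have "(z - ?l) * Z z $ j = (\<Sum>i\<in>UNIV. of_real (P $ i $ j) *
           (z * (Z ?l $ i - ?l / (of_real mu + ?l) * Z (?l + of_real (mu * c)) $ i)
            - ?l * (Z z $ i - \<kappa> * Z (z + of_real h) $ i)))"
        by (simp only: h_def) (rule LIMSEQ_unique)
      (* The part at the arguments ?l and ?l + mu * c depends on z through the factor z alone: it is v. *)
      also have "\<dots> = z * v $ j
        - ?l * (\<Sum>i\<in>UNIV. of_real (P $ i $ j) * (Z z $ i - \<kappa> * Z (z + of_real h) $ i))"
        by (simp add: v_def v_vec_def sum_distrib_left right_diff_distrib sum_subtractf mult.left_commute)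
      finally show ?thesis .
    qed
    let ?L = "Lambda_mat lam" and ?R = "transpose (cmatrix P)"
    have "D_mat P lam z *v Z z = z *s (v + (1 / (of_real mu + z)) *s (?L *v (?R *v Z (z + of_real h))))"
    proof (subst vec_eq_iff, intro allI)
      fix j
      have "(D_mat P lam z *v Z z) $ j
        = (z - of_real (lam $ j)) * Z z $ j + of_real (lam $ j) * (\<Sum>i\<in>UNIV. of_real (P $ i $ j) * Z z $ i)"
        by (simp add: D_mat_mult_vec Lambda_mat_mult_vec transpose_cmatrix_mult_vec
            matrix_vector_mult_diff_rdistrib algebra_simps del: transpose_matrix_vector flip: matrix_vector_mul_assoc)
      also have "\<dots> = z * v $ j
          + of_real (lam $ j) * (\<kappa> * (\<Sum>i\<in>UNIV. of_real (P $ i $ j) * Z (z + of_real h) $ i))"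
        unfolding bal by (simp add: right_diff_distrib sum_subtractf sum_distrib_left mult.left_commute)
      also have "\<dots> = (z *s (v + (1 / (of_real mu + z)) *s (?L *v (?R *v Z (z + of_real h))))) $ j"
        by (simp add: Lambda_mat_mult_vec transpose_cmatrix_mult_vec \<kappa>_def algebra_simps
            del: transpose_matrix_vector)
      finally show "(D_mat P lam z *v Z z) $ j
        = (z *s (v + (1 / (of_real mu + z)) *s (?L *v (?R *v Z (z + of_real h))))) $ j" .
    qed
    from A_mat_unique[OF detz this] show ?thesis
      by (simp add: M_mat_def scale_mat_mult_vec matrix_vector_right_distrib vector_scalar_commute
          matrix_vector_mul_assoc matrix_mul_assoc del: transpose_matrix_vector)
  qed

  have det': "det (D_mat P lam (\<sigma> l)) \<noteq> 0" for l
    using det[of l] unfolding \<sigma>_def h_def .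
  have "(\<lambda>k. (ordered_prod (\<lambda>l. M_mat P lam mu (\<sigma> l)) k ** A_mat P lam (\<sigma> k)) *v v) sums Z (\<sigma> 0)"
  proof (rule sums_ordered_prod_if_recursion[where z = "\<lambda>k. Z (\<sigma> k)"])
    show "Z (\<sigma> k) = A_mat P lam (\<sigma> k) *v v + M_mat P lam mu (\<sigma> k) *v Z (\<sigma> (Suc k))" for k
    proof -
      have "\<sigma> k + of_real h = \<sigma> (Suc k)" by (simp add: \<sigma>_def algebra_simps)
      with rec[OF Re\<sigma>[of k] det'[of k]] show ?thesis by (simp only:)
    qed
    show "(\<lambda>k. ordered_prod (\<lambda>l. M_mat P lam mu (\<sigma> l)) k *v Z (\<sigma> k)) \<longlonglongrightarrow> 0"
    proof (rule ordered_prod_mult_tendsto_zero)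
      show "\<forall>\<^sub>F l in sequentially. \<forall>y. norm (M_mat P lam mu (\<sigma> l) *v y) \<le> norm y / 2"
        using eventually_norm_M_mat_le[OF h mu s det'[unfolded \<sigma>_def]] by (simp only: \<sigma>_def)
      show "norm (Z (\<sigma> k)) \<le> real CARD('n)" for k
        by (rule Z_bound[OF Re\<sigma>])
    qed
  qed
  thus ?thesis
    by (simp add: \<sigma>_def h_def Z_def v_def)
qed

end
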